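(* Let $f$ and $g$ be transcendental entire functions that are permutable, i.e. $f\circ g=g\circ f$. Then: (i) $F(f\circ g)$ is completely invariant under $f$ and under $g$; (ii) $F(f\circ g)\subset F(f)\cap F(g)$; (iii) for any two positive integers $i$ and $j$, $F(f^i\circ g^j)=F(f\circ g)$.
   Context: For a transcendental entire function $h:\mathbb{C}\to\mathbb{C}$, $h^n$ denotes its $n$-th iterate, and the Fatou set of $h$ is $F(h)=\{z\in\mathbb{C}: \{h^n\}_{n\in\mathbb{N}} \text{ is normal in some neighborhood of } z\}$, where normality is in the usual sense for families of holomorphic functions, with locally uniform convergence to the constant $\infty$ allowed. A set $A\subset\mathbb{C}$ is completely invariant under $h$ if for every $z\in\mathbb{C}$: $z\in A$ if and only if $h(z)\in A$. *)

theory Defs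
  imports "HOL-Complex_Analysis.Complex_Analysis" "HOL-Computational_Algebra.Polynomial"
begin

definition transcendental_entire :: "(complex \<Rightarrow> complex) \<Rightarrow> bool" where
  "transcendental_entire h \<longleftrightarrow> h holomorphic_on UNIV \<and> \<not> (\<exists>p. h = poly p)"

definition locally_uniformly_convergent_on ::
    "complex set \<Rightarrow> (nat \<Rightarrow> complex \<Rightarrow> complex) \<Rightarrow> (complex \<Rightarrow> complex) \<Rightarrow> bool" where
  "locally_uniformly_convergent_on U s l \<longleftrightarrow>
     (\<forall>z\<in>U. \<exists>V. open V \<and> z \<in> V \<and> V \<subseteq> U \<and> uniform_limit V s l sequentially)"

definition locally_uniformly_infinite_on ::
    "complex set \<Rightarrow> (nat \<Rightarrow> complex \<Rightarrow> complex) \<Rightarrow> bool" where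
  "locally_uniformly_infinite_on U s \<longleftrightarrow>
     (\<forall>z\<in>U. \<exists>V. open V \<and> z \<in> V \<and> V \<subseteq> U \<and>
        (\<forall>B. \<forall>\<^sub>F n in sequentially. \<forall>w\<in>V. B < norm (s n w)))"

text \<open>
  Intended for an open set \<open>U\<close> and a family of functions holomorphic on \<open>U\<close>; the finite limit
  \<open>l\<close> is then automatically holomorphic on \<open>U\<close>.
\<close>

definition normal_family_on :: "complex set \<Rightarrow> (complex \<Rightarrow> complex) set \<Rightarrow> bool" where
  "normal_family_on U \<F> \<longleftrightarrow>
     (\<forall>s :: nat \<Rightarrow> complex \<Rightarrow> complex. range s \<subseteq> \<F> \<longrightarrow>
        (\<exists>r :: nat \<Rightarrow> nat. strict_mono r \<and>
           ((\<exists>l. locally_uniformly_convergent_on U (s \<circ> r) l) \<or>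
            locally_uniformly_infinite_on U (s \<circ> r))))"

definition fatou_set :: "(complex \<Rightarrow> complex) \<Rightarrow> complex set" where
  "fatou_set h = {z. \<exists>U. open U \<and> z \<in> U \<and> normal_family_on U (range (\<lambda>n. h ^^ n))}"

definition completely_invariant :: "(complex \<Rightarrow> complex) \<Rightarrow> complex set \<Rightarrow> bool" where
  "completely_invariant h A \<longleftrightarrow> (\<forall>z. z \<in> A \<longleftrightarrow> h z \<in> A)"

end

theory Submission
  imports Defs
begin

text \<open>
  Put \<open>h = f \<circ> g = g \<circ> f\<close>. By Montel's theorem, normality of \<open>{g \<circ> \<psi>}\<close> implies normality of
  \<open>{\<psi>}\<close> for every nonconstant entire \<open>g\<close>. Since \<open>h\<^sup>n \<circ> f = f \<circ> h\<^sup>n\<close> and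
  \<open>g \<circ> (f \<circ> h\<^sup>n) = h ^^ Suc n\<close>, cancelling \<open>g\<close> (respectively \<open>f\<close>) gives the two directions of
  \<open>z \<in> F(h) \<longleftrightarrow> f z \<in> F(h)\<close>, without using the density of repelling periodic points.

  The Fatou set of a transcendental entire function omits at least two points. Hence any entire
  function mapping \<open>F(h)\<close> into itself has, again by Montel, normal iterates on \<open>F(h)\<close>. This gives
  (ii) and one inclusion of (iii); the other one follows in the same way because
  \<open>F(f\<^sup>i \<circ> g\<^sup>j)\<close> is completely invariant under \<open>f\<close>, which commutes with \<open>f ^^ (i - 1) \<circ> g\<^sup>j\<close>, and
  likewise under \<open>g\<close>.
\<close>

section \<open>Normality at a point\<close>

text \<open>On a compact set locally uniform and uniform convergence agree, so both alternatives of
  normality can be tested on one closed disc, without a neighbourhood for each point.\<close>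

definition conv_or_escape :: "complex set \<Rightarrow> (nat \<Rightarrow> complex \<Rightarrow> complex) \<Rightarrow> bool" where
  "conv_or_escape K s \<longleftrightarrow> (\<exists>l. uniform_limit K s l sequentially) \<or>
     (\<forall>B. \<forall>\<^sub>F n in sequentially. \<forall>w\<in>K. B < norm (s n w))"

text \<open>One radius serves all sequences. The family is an arbitrary set of functions, since
  families such as the \<open>f \<circ> h ^^ n\<close> have to be treated besides the
  iterates.\<close>

definition normal_at :: "complex \<Rightarrow> (complex \<Rightarrow> complex) set \<Rightarrow> bool" where
  "normal_at z F \<longleftrightarrow> (\<exists>r>0. \<forall>s :: nat \<Rightarrow> complex \<Rightarrow> complex. range s \<subseteq> F \<longrightarrow>
     (\<exists>k :: nat \<Rightarrow> nat. strict_mono k \<and> conv_or_escape (cball z r) (s \<circ> k)))"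

lemma normal_atI:
  assumes "r > 0"
    and "\<And>s :: nat \<Rightarrow> complex \<Rightarrow> complex. range s \<subseteq> F \<Longrightarrow>
      \<exists>k :: nat \<Rightarrow> nat. strict_mono k \<and> conv_or_escape (cball z r) (s \<circ> k)"
  shows "normal_at z F"
  using assms unfolding normal_at_def by blast

lemma normal_atE:
  assumes "normal_at z F"
  obtains r where "r > 0"
    and "\<And>s :: nat \<Rightarrow> complex \<Rightarrow> complex. range s \<subseteq> F \<Longrightarrow>
      \<exists>k :: nat \<Rightarrow> nat. strict_mono k \<and> conv_or_escape (cball z r) (s \<circ> k)"
  using assms unfolding normal_at_def by blast

lemma normal_at_mono: "normal_at z F \<Longrightarrow> G \<subseteq> F \<Longrightarrow> normal_at z G"
  unfolding normal_at_def using order_trans by metis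

lemma conv_or_escape_subset:
  assumes "conv_or_escape K s" "L \<subseteq> K"
  shows "conv_or_escape L s"
proof -
  have "\<forall>\<^sub>F n in sequentially. \<forall>w\<in>L. B < norm (s n w)"
    if "\<forall>\<^sub>F n in sequentially. \<forall>w\<in>K. B < norm (s n w)" for B
    using that by (rule eventually_mono) (use assms(2) in blast)
  then show ?thesis
    using assms uniform_limit_on_subset unfolding conv_or_escape_def by blast
qed

lemma conv_or_escape_affine:
  assumes "conv_or_escape K s" "c \<noteq> 0"
  shows "conv_or_escape K (\<lambda>n w. a + c * s n w)"
proof -
  consider l where "uniform_limit K s l sequentially"
    | "\<forall>B. \<forall>\<^sub>F n in sequentially. \<forall>w\<in>K. B < norm (s n w)"
    using assms(1) unfolding conv_or_escape_def by blast
  then show ?thesis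
  proof cases
    case 1
    have "uniform_limit K (\<lambda>n w. a + c * s n w) (\<lambda>w. a + c * l w) sequentially"
      by (intro uniform_limit_intros bounded_linear.uniform_limit[OF bounded_linear_mult_right] 1)
    then show ?thesis unfolding conv_or_escape_def by blast
  next
    case 2
    have "\<forall>\<^sub>F n in sequentially. \<forall>w\<in>K. B < norm (a + c * s n w)" for B
    proof -
      have "\<forall>\<^sub>F n in sequentially. \<forall>w\<in>K. (B + norm a) / norm c < norm (s n w)"
        using 2 by blast
      then show ?thesis
      proof eventually_elim
        case (elim n)
        show ?case
        proof
          fix w assume "w \<in> K"
          then have "B + norm a < norm (c * s n w)"
            using elim assms(2) by (simp add: norm_mult divide_simps mult.commute)
          then show "B < norm (a + c * s n w)"
            using norm_triangle_ineq[of "a + c * s n w" "- a"] by simp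
        qed
      qed
    qed
    then show ?thesis unfolding conv_or_escape_def by blast
  qed
qed

text \<open>From left to right, compactness covers a closed disc by finitely many of the
  neighbourhoods that local uniformity provides. Conversely, the open disc itself serves as
  neighbourhood of each of its points.\<close>

lemma fatou_set_iff_normal_at:
  "z \<in> fatou_set h \<longleftrightarrow> normal_at z (range (\<lambda>n. h ^^ n))"
proof
  assume "z \<in> fatou_set h"
  then obtain U where U: "open U" "z \<in> U" and N: "normal_family_on U (range (\<lambda>n. h ^^ n))"
    unfolding fatou_set_def by blast
  then obtain r where r: "r > 0" "cball z r \<subseteq> U"
    using open_contains_cball by metis
  show "normal_at z (range (\<lambda>n. h ^^ n))"
  proof (rule normal_atI[OF r(1)])
    fix s :: "nat \<Rightarrow> complex \<Rightarrow> complex" assume "range s \<subseteq> range (\<lambda>n. h ^^ n)"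
    then obtain k where k: "strict_mono k"
      and alt: "(\<exists>l. locally_uniformly_convergent_on U (s \<circ> k) l) \<or>
            locally_uniformly_infinite_on U (s \<circ> k)"
      using N unfolding normal_family_on_def by blast
    have cover: "\<exists>D. finite D \<and> D \<subseteq> U \<and> cball z r \<subseteq> (\<Union>x\<in>D. V x)"
      if "\<And>x. x \<in> U \<Longrightarrow> open (V x) \<and> x \<in> V x" for V
    proof -
      have "cball z r \<subseteq> (\<Union>x\<in>U. V x)" using r(2) that by blast
      then show ?thesis
        using compactE_image[OF compact_cball, of U V z r] that by metis
    qed
    from alt have "conv_or_escape (cball z r) (s \<circ> k)"
    proof
      assume "\<exists>l. locally_uniformly_convergent_on U (s \<circ> k) l"
      then obtain l V where V: "\<And>x. x \<in> U \<Longrightarrow> open (V x) \<and> x \<in> V x"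
        and lim: "\<And>x. x \<in> U \<Longrightarrow> uniform_limit (V x) (s \<circ> k) l sequentially"
        unfolding locally_uniformly_convergent_on_def by metis
      obtain D where D: "finite D" "D \<subseteq> U" "cball z r \<subseteq> (\<Union>x\<in>D. V x)"
        using cover[OF V] by metis
      then have "uniform_limit (\<Union>(V ` D)) (s \<circ> k) l sequentially"
        by (intro uniform_limit_on_Union) (auto intro: lim)
      then show ?thesis
        unfolding conv_or_escape_def using uniform_limit_on_subset D(3) by blast
    next
      assume "locally_uniformly_infinite_on U (s \<circ> k)"
      then have "\<forall>x\<in>U. \<exists>V. open V \<and> x \<in> V \<and>
          (\<forall>B. \<forall>\<^sub>F n in sequentially. \<forall>w\<in>V. B < norm ((s \<circ> k) n w))"
        unfolding locally_uniformly_infinite_on_def by blast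
      from bchoice[OF this] obtain V where V: "\<And>x. x \<in> U \<Longrightarrow> open (V x) \<and> x \<in> V x"
        and lim: "\<And>x B. x \<in> U \<Longrightarrow> \<forall>\<^sub>F n in sequentially. \<forall>w\<in>V x. B < norm ((s \<circ> k) n w)"
        by blast
      obtain D where D: "finite D" "D \<subseteq> U" "cball z r \<subseteq> (\<Union>x\<in>D. V x)"
        using cover[OF V] by metis
      have "\<forall>\<^sub>F n in sequentially. \<forall>w\<in>cball z r. B < norm ((s \<circ> k) n w)" for B
      proof -
        have "\<forall>\<^sub>F n in sequentially. \<forall>x\<in>D. \<forall>w\<in>V x. B < norm ((s \<circ> k) n w)"
          using D lim by (intro eventually_ball_finite) auto
        then show ?thesis by (rule eventually_mono) (use D(3) in blast)
      qed
      then show ?thesis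
        unfolding conv_or_escape_def by blast
    qed
    with k show "\<exists>k. strict_mono k \<and> conv_or_escape (cball z r) (s \<circ> k)" by blast
  qed
next
  assume "normal_at z (range (\<lambda>n. h ^^ n))"
  then obtain r where r: "r > 0"
    and sub: "\<And>s :: nat \<Rightarrow> complex \<Rightarrow> complex. range s \<subseteq> range (\<lambda>n. h ^^ n) \<Longrightarrow>
      \<exists>k :: nat \<Rightarrow> nat. strict_mono k \<and> conv_or_escape (cball z r) (s \<circ> k)"
    by (rule normal_atE) blast
  have "normal_family_on (ball z r) (range (\<lambda>n. h ^^ n))"
    unfolding normal_family_on_def
  proof (intro allI impI)
    fix s :: "nat \<Rightarrow> complex \<Rightarrow> complex" assume "range s \<subseteq> range (\<lambda>n. h ^^ n)"
    then obtain k where k: "strict_mono k" and ce: "conv_or_escape (cball z r) (s \<circ> k)"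
      using sub by blast
    have "conv_or_escape (ball z r) (s \<circ> k)"
      using ce ball_subset_cball by (rule conv_or_escape_subset)
    then have "(\<exists>l. locally_uniformly_convergent_on (ball z r) (s \<circ> k) l) \<or>
            locally_uniformly_infinite_on (ball z r) (s \<circ> k)"
      unfolding conv_or_escape_def locally_uniformly_convergent_on_def
        locally_uniformly_infinite_on_def
      using open_ball by blast
    with k show "\<exists>k. strict_mono k \<and>
        ((\<exists>l. locally_uniformly_convergent_on (ball z r) (s \<circ> k) l) \<or>
         locally_uniformly_infinite_on (ball z r) (s \<circ> k))" by blast
  qed
  then show "z \<in> fatou_set h"
    unfolding fatou_set_def using r open_ball centre_in_ball by blast
qed

lemma fatou_set_open: "open (fatou_set h)"
  by (subst open_subopen) (auto simp: fatou_set_def)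

section \<open>Montel's theorem for families omitting two values\<close>

text \<open>A bound at the centre spreads to every compact subset by \<open>GPicard3\<close>, a
  consequence of Schottky's theorem; the classical theorem of Montel for locally bounded families
  then applies.\<close>

lemma Montel_omit_01_bounded_center:
  fixes s :: "nat \<Rightarrow> complex \<Rightarrow> complex"
  assumes R: "0 < R" and hol: "\<And>n. s n holomorphic_on ball z R"
    and omit: "\<And>n w. w \<in> ball z R \<Longrightarrow> s n w \<noteq> 0 \<and> s n w \<noteq> 1"
    and center: "\<And>n. norm (s n z) \<le> 1"
  obtains g k where "g holomorphic_on ball z R" "strict_mono (k :: nat \<Rightarrow> nat)"
    "\<And>K. compact K \<Longrightarrow> K \<subseteq> ball z R \<Longrightarrow> uniform_limit K (s \<circ> k) g sequentially"
proof -
  have bnd: "\<exists>B. \<forall>h\<in>range s. \<forall>w\<in>K. norm (h w) \<le> B" if K: "compact K" "K \<subseteq> ball z R" for K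
  proof -
    obtain B where "\<And>h w. h \<in> range s \<Longrightarrow> w \<in> K \<Longrightarrow> norm (h w) \<le> B"
    proof (rule GPicard3[of "ball z R" z "range s" "range s" K])
      show "open (ball z R)" "connected (ball z R)" "z \<in> ball z R" using R by auto
    qed (use K hol omit center in auto)
    then show ?thesis by blast
  qed
  show ?thesis
  proof (rule Montel[of "ball z R" "range s" s])
    fix h assume "h \<in> range s"
    then show "h holomorphic_on ball z R" using hol by auto
  qed (use bnd that in auto)
qed

text \<open>If infinitely many centre values lie in the closed unit disc, that subsequence is
  handled directly. Otherwise infinitely many reciprocals are bounded by 1 at the centre, and they
  omit 0 and 1 too. By Hurwitz, their limit \<open>g\<close> either has no zero, and the original
  functions converge to \<open>inverse \<circ> g\<close>, or vanishes identically, and they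
  escape.\<close>

lemma Montel_omit_01:
  fixes s :: "nat \<Rightarrow> complex \<Rightarrow> complex"
  assumes R: "0 < R" "r < R" and hol: "\<And>n. s n holomorphic_on ball z R"
    and omit: "\<And>n w. w \<in> ball z R \<Longrightarrow> s n w \<noteq> 0 \<and> s n w \<noteq> 1"
  obtains k where "strict_mono (k :: nat \<Rightarrow> nat)" "conv_or_escape (cball z r) (s \<circ> k)"
proof (cases "infinite {n. norm (s n z) \<le> 1}")
  case True
  then obtain k0 :: "nat \<Rightarrow> nat" where k0: "strict_mono k0" "\<And>n. norm (s (k0 n) z) \<le> 1"
    using infinite_enumerate by blast
  obtain g k where "g holomorphic_on ball z R" "strict_mono (k :: nat \<Rightarrow> nat)"
    and lim: "\<And>K. compact K \<Longrightarrow> K \<subseteq> ball z R \<Longrightarrow>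
        uniform_limit K ((\<lambda>n. s (k0 n)) \<circ> k) g sequentially"
  proof (rule Montel_omit_01_bounded_center[where s = "\<lambda>n. s (k0 n)" and z = z, OF R(1)])
    show "s (k0 n) holomorphic_on ball z R" "norm (s (k0 n) z) \<le> 1" for n
      by (rule hol k0(2))+
    show "s (k0 n) w \<noteq> 0 \<and> s (k0 n) w \<noteq> 1" if "w \<in> ball z R" for n w
      using omit[OF that] .
  qed (use that in blast)
  have "uniform_limit (cball z r) ((\<lambda>n. s (k0 n)) \<circ> k) g sequentially"
    using lim R by (simp add: cball_subset_ball_iff)
  then have "conv_or_escape (cball z r) (s \<circ> (k0 \<circ> k))"
    unfolding conv_or_escape_def by (auto simp: o_def)
  moreover have "strict_mono (k0 \<circ> k)"
    using k0(1) \<open>strict_mono k\<close> by (rule strict_mono_o)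
  ultimately show ?thesis using that by blast
next
  case False
  have "infinite {n. norm (s n z) > 1}"
  proof
    assume "finite {n. norm (s n z) > 1}"
    with False have "finite ({n. norm (s n z) \<le> 1} \<union> {n. norm (s n z) > 1})" by simp
    moreover have "{n. norm (s n z) \<le> 1} \<union> {n. norm (s n z) > 1} = UNIV" by auto
    ultimately show False by simp
  qed
  then obtain k0 :: "nat \<Rightarrow> nat" where k0: "strict_mono k0" "\<And>n. norm (s (k0 n) z) > 1"
    using infinite_enumerate by blast
  define t where "t n w = inverse (s (k0 n) w)" for n w
  have t_hol: "t n holomorphic_on ball z R" for n
    unfolding t_def using hol omit by (intro holomorphic_on_inverse) auto
  have t_omit: "t n w \<noteq> 0 \<and> t n w \<noteq> 1" if "w \<in> ball z R" for n w
    unfolding t_def using omit[OF that] by (simp add: inverse_eq_1_iff)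
  have t_center: "norm (t n z) \<le> 1" for n
    unfolding t_def using k0(2)[of n] by (simp add: norm_inverse inverse_le_1_iff)
  obtain g k where g: "g holomorphic_on ball z R" and k: "strict_mono (k :: nat \<Rightarrow> nat)"
    and lim: "\<And>K. compact K \<Longrightarrow> K \<subseteq> ball z R \<Longrightarrow> uniform_limit K (t \<circ> k) g sequentially"
  proof (rule Montel_omit_01_bounded_center[where s = t and z = z, OF R(1) t_hol t_omit t_center])
    fix g k
    assume "g holomorphic_on ball z R" "strict_mono (k :: nat \<Rightarrow> nat)"
      "\<And>K. compact K \<Longrightarrow> K \<subseteq> ball z R \<Longrightarrow> uniform_limit K (t \<circ> k) g sequentially"
    then show thesis by (rule that)
  qed
  let ?K = "cball z r"
  have K: "?K \<subseteq> ball z R" using R by (simp add: cball_subset_ball_iff)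
  have limK: "uniform_limit ?K (t \<circ> k) g sequentially"
    using lim K by simp
  have s_eq: "(s \<circ> (k0 \<circ> k)) = (\<lambda>n w. inverse ((t \<circ> k) n w))"
    by (auto simp: t_def fun_eq_iff)
  have "conv_or_escape ?K (s \<circ> (k0 \<circ> k))"
  proof (cases "\<exists>w\<in>ball z R. g w = 0")
    case False
    have cont: "continuous_on ?K g"
      using g K by (meson holomorphic_on_imp_continuous_on continuous_on_subset)
    \<comment> \<open>A positive lower bound for the limit lets uniform convergence pass to
      reciprocals. The disc is empty for negative \<open>r\<close>, and then 1 will do.\<close>
    have "\<exists>b>0. \<forall>w\<in>?K. b \<le> norm (g w)"
    proof (cases "?K = {}")
      case False
      then obtain w0 where "w0 \<in> ?K" "\<forall>w\<in>?K. norm (g w0) \<le> norm (g w)"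
        using continuous_attains_inf[of ?K "\<lambda>w. norm (g w)"] cont
        by (metis compact_cball continuous_on_norm)
      then show ?thesis
        using \<open>\<not> (\<exists>w\<in>ball z R. g w = 0)\<close> K by (intro exI[of _ "norm (g w0)"]) auto
    qed (auto intro: exI[of _ 1])
    then obtain b where b: "b > 0" "\<And>w. w \<in> ?K \<Longrightarrow> b \<le> norm (g w)" by blast
    have "uniform_limit ?K (\<lambda>n w. inverse ((t \<circ> k) n w)) (inverse \<circ> g) sequentially"
      using uniform_lim_inverse[OF limK b(2) b(1)] by (simp add: o_def)
    then show ?thesis
      unfolding conv_or_escape_def s_eq by blast
  next
    case True
    have "g constant_on ball z R"
    proof (rule ccontr)
      assume nc: "\<not> g constant_on ball z R"
      have "g w \<noteq> 0" if w: "w \<in> ball z R" for w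
      proof (rule Hurwitz_no_zeros[where \<F> = "t \<circ> k" and g = g, OF open_ball connected_ball])
        show "(t \<circ> k) n holomorphic_on ball z R" for n using t_hol by simp
        show "uniform_limit K (t \<circ> k) g sequentially" if "compact K" "K \<subseteq> ball z R" for K
          using that by (rule lim)
        show "(t \<circ> k) n x \<noteq> 0" if "x \<in> ball z R" for n x using t_omit[OF that] by simp
      qed (fact g nc w)+
      with True show False by blast
    qed
    with True have g0: "g w = 0" if "w \<in> ball z R" for w
      using that unfolding constant_on_def by metis
    have "\<forall>\<^sub>F n in sequentially. \<forall>w\<in>?K. B < norm ((s \<circ> (k0 \<circ> k)) n w)" for B
    proof -
      \<comment> \<open>A reciprocal of modulus below \<open>e\<close> comes from a value of modulus
        above \<open>\<bar>B\<bar> + 1\<close>.\<close>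
      define e where "e = 1 / (\<bar>B\<bar> + 1)"
      have e: "e > 0" unfolding e_def by simp
      have "\<forall>\<^sub>F n in sequentially. \<forall>w\<in>?K. dist ((t \<circ> k) n w) (g w) < e"
        using limK e unfolding uniform_limit_iff by blast
      then show ?thesis
      proof eventually_elim
        case (elim n)
        show ?case
        proof
          fix w assume w: "w \<in> ?K"
          have "g w = 0" using g0 w K by blast
          then have "norm ((t \<circ> k) n w) < e" using elim w by (metis dist_0_norm dist_commute)
          moreover have "0 < norm ((t \<circ> k) n w)" using t_omit w K by auto
          ultimately have "1 / e < 1 / norm ((t \<circ> k) n w)"
            by (intro divide_strict_left_mono) (auto simp: e)
          then have "\<bar>B\<bar> + 1 < norm (inverse ((t \<circ> k) n w))"
            unfolding e_def by (simp add: norm_inverse divide_inverse)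
          then show "B < norm ((s \<circ> (k0 \<circ> k)) n w)" unfolding s_eq by linarith
        qed
      qed
    qed
    then show ?thesis unfolding conv_or_escape_def by blast
  qed
  moreover have "strict_mono (k0 \<circ> k)"
    using k0(1) k by (rule strict_mono_o)
  ultimately show ?thesis using that by blast
qed

text \<open>The affine map sending \<open>a\<close> to 0 and \<open>b\<close> to 1 reduces this to
  the normalized case; \<open>conv_or_escape_affine\<close> undoes it.\<close>

theorem Montel_omit_two_values:
  fixes s :: "nat \<Rightarrow> complex \<Rightarrow> complex"
  assumes R: "0 < R" "r < R" and hol: "\<And>n. s n holomorphic_on ball z R"
    and "a \<noteq> b" and omit: "\<And>n w. w \<in> ball z R \<Longrightarrow> s n w \<noteq> a \<and> s n w \<noteq> b"
  obtains k where "strict_mono (k :: nat \<Rightarrow> nat)" "conv_or_escape (cball z r) (s \<circ> k)"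
proof -
  define t where "t n w = (s n w - a) / (b - a)" for n w
  have "t n holomorphic_on ball z R" for n
    unfolding t_def using hol \<open>a \<noteq> b\<close> by (intro holomorphic_intros) auto
  moreover have "t n w \<noteq> 0 \<and> t n w \<noteq> 1" if "w \<in> ball z R" for n w
    using omit[OF that, of n] \<open>a \<noteq> b\<close> unfolding t_def by simp
  ultimately obtain k where k: "strict_mono (k :: nat \<Rightarrow> nat)" and ce: "conv_or_escape (cball z r) (t \<circ> k)"
    using Montel_omit_01[OF R] by metis
  have "s \<circ> k = (\<lambda>n w. a + (b - a) * (t \<circ> k) n w)"
    using \<open>a \<noteq> b\<close> by (simp add: t_def fun_eq_iff)
  with conv_or_escape_affine[OF ce, of "b - a" a] \<open>a \<noteq> b\<close> k that show ?thesis by simp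
qed

section \<open>Cancellation and complete invariance\<close>

lemma conv_or_escape_image_iff:
  "conv_or_escape (f ` K) s \<longleftrightarrow> conv_or_escape K (\<lambda>n. s n \<circ> f)"
proof -
  have "(\<exists>l. uniform_limit (f ` K) s l sequentially) \<longleftrightarrow>
      (\<exists>l. uniform_limit K (\<lambda>n. s n \<circ> f) l sequentially)"
  proof
    assume "\<exists>l. uniform_limit (f ` K) s l sequentially"
    then obtain l where "uniform_limit (f ` K) s l sequentially" by blast
    then have "uniform_limit K (\<lambda>n. s n \<circ> f) (l \<circ> f) sequentially"
      by (simp add: uniform_limit_iff)
    then show "\<exists>l. uniform_limit K (\<lambda>n. s n \<circ> f) l sequentially" by blast
  next
    assume "\<exists>l. uniform_limit K (\<lambda>n. s n \<circ> f) l sequentially"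
    then obtain l where l: "uniform_limit K (\<lambda>n. s n \<circ> f) l sequentially" by blast
    \<comment> \<open>Each point of the image is given one preimage in \<open>K\<close>; the uniform
      estimate at that preimage is the required one.\<close>
    have "uniform_limit (f ` K) s (l \<circ> inv_into K f) sequentially"
      unfolding uniform_limit_iff
    proof (intro allI impI)
      fix e :: real assume "e > 0"
      then have "\<forall>\<^sub>F n in sequentially. \<forall>x\<in>K. dist ((s n \<circ> f) x) (l x) < e"
        using l unfolding uniform_limit_iff by blast
      then show "\<forall>\<^sub>F n in sequentially. \<forall>w\<in>f ` K. dist (s n w) ((l \<circ> inv_into K f) w) < e"
      proof (rule eventually_mono, intro ballI)
        fix n w assume near: "\<forall>x\<in>K. dist ((s n \<circ> f) x) (l x) < e" and w: "w \<in> f ` K"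
        show "dist (s n w) ((l \<circ> inv_into K f) w) < e"
          using bspec[OF near inv_into_into[OF w]] f_inv_into_f[OF w] by simp
      qed
    qed
    then show "\<exists>l. uniform_limit (f ` K) s l sequentially" by blast
  qed
  then show ?thesis unfolding conv_or_escape_def by simp
qed

text \<open>By continuity \<open>f\<close> maps a small closed disc about \<open>z\<close> into the
  disc of normality about \<open>f z\<close>.\<close>

lemma normal_at_precompose:
  assumes f: "f holomorphic_on UNIV" and N: "normal_at (f z) F"
  shows "normal_at z ((\<lambda>\<psi>. \<psi> \<circ> f) ` F)"
proof -
  obtain r where r: "r > 0" and sub: "\<And>s :: nat \<Rightarrow> complex \<Rightarrow> complex. range s \<subseteq> F \<Longrightarrow>
      \<exists>k :: nat \<Rightarrow> nat. strict_mono k \<and> conv_or_escape (cball (f z) r) (s \<circ> k)"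
    using N by (rule normal_atE) blast
  have "isCont f z"
    using holomorphic_on_imp_continuous_on[OF f] by (simp add: continuous_on_eq_continuous_at)
  then obtain d0 where d0: "d0 > 0" "\<And>w. dist w z < d0 \<Longrightarrow> dist (f w) (f z) < r"
    using r unfolding continuous_at_eps_delta dist_norm by blast
  \<comment> \<open>Halving puts the closed disc inside the open disc of radius
    \<open>d0\<close>.\<close>
  define d where "d = d0 / 2"
  have "d > 0" using d0 by (simp add: d_def)
  have im: "f ` cball z d \<subseteq> cball (f z) r"
  proof (intro image_subsetI)
    fix w assume "w \<in> cball z d"
    then have "dist w z < d0" using d0(1) by (simp add: d_def dist_commute)
    then show "f w \<in> cball (f z) r" using d0(2)[of w] by (simp add: dist_commute)
  qed
  show ?thesis
  proof (rule normal_atI[OF \<open>d > 0\<close>])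
    fix s :: "nat \<Rightarrow> complex \<Rightarrow> complex" assume s: "range s \<subseteq> (\<lambda>\<psi>. \<psi> \<circ> f) ` F"
    then have "\<forall>n. \<exists>\<psi>\<in>F. s n = \<psi> \<circ> f" by blast
    then obtain t where t: "\<And>n. t n \<in> F" "\<And>n. s n = t n \<circ> f" by metis
    then obtain k :: "nat \<Rightarrow> nat" where k: "strict_mono k" "conv_or_escape (cball (f z) r) (t \<circ> k)"
      using sub[of t] by blast
    have "conv_or_escape (cball z d) (\<lambda>n. (t \<circ> k) n \<circ> f)"
      unfolding conv_or_escape_image_iff[symmetric] using k(2) im by (rule conv_or_escape_subset)
    moreover have "s \<circ> k = (\<lambda>n. (t \<circ> k) n \<circ> f)" using t(2) by auto
    ultimately show "\<exists>k :: nat \<Rightarrow> nat. strict_mono k \<and> conv_or_escape (cball z d) (s \<circ> k)"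
      using k(1) by auto
  qed
qed

text \<open>By the open mapping theorem the image of a disc about \<open>z\<close> contains a closed
  disc about \<open>f z\<close>, to which convergence is transported.\<close>

lemma normal_at_precompose_cancel:
  assumes f: "f holomorphic_on UNIV" "\<not> f constant_on UNIV"
    and N: "normal_at z ((\<lambda>\<psi>. \<psi> \<circ> f) ` F)"
  shows "normal_at (f z) F"
proof -
  obtain r where r: "r > 0" and sub: "\<And>s :: nat \<Rightarrow> complex \<Rightarrow> complex.
      range s \<subseteq> (\<lambda>\<psi>. \<psi> \<circ> f) ` F \<Longrightarrow>
      \<exists>k :: nat \<Rightarrow> nat. strict_mono k \<and> conv_or_escape (cball z r) (s \<circ> k)"
    using N by (rule normal_atE) blast
  have "open (f ` ball z r)"
    using open_mapping_thm[OF f(1) open_UNIV connected_UNIV open_ball subset_UNIV f(2)] .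
  moreover have "f z \<in> f ` ball z r" using r by simp
  ultimately obtain d where d: "d > 0" "cball (f z) d \<subseteq> f ` ball z r"
    using open_contains_cball by metis
  then have im: "cball (f z) d \<subseteq> f ` cball z r"
    using ball_subset_cball by blast
  show ?thesis
  proof (rule normal_atI[OF d(1)])
    fix s :: "nat \<Rightarrow> complex \<Rightarrow> complex" assume s: "range s \<subseteq> F"
    then obtain k :: "nat \<Rightarrow> nat" where k: "strict_mono k"
      and ce: "conv_or_escape (cball z r) ((\<lambda>n. s n \<circ> f) \<circ> k)"
      using sub[of "\<lambda>n. s n \<circ> f"] by blast
    have "conv_or_escape (f ` cball z r) (s \<circ> k)"
      using ce by (simp add: conv_or_escape_image_iff comp_def)
    then have "conv_or_escape (cball (f z) d) (s \<circ> k)"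
      using im by (rule conv_or_escape_subset)
    with k show "\<exists>k :: nat \<Rightarrow> nat. strict_mono k \<and> conv_or_escape (cball (f z) d) (s \<circ> k)"
      by blast
  qed
qed

lemma entire_unbounded:
  assumes "g holomorphic_on UNIV" "\<not> g constant_on UNIV"
  obtains w where "C < norm (g w)"
proof -
  have "\<not> bounded (range g)" using Liouville_theorem[OF assms(1)] assms(2) by blast
  then have "\<exists>w. C < norm (g w)" unfolding bounded_iff by (force simp: not_le)
  then show ?thesis using that by blast
qed

text \<open>
  If \<open>g \<circ> \<psi>\<close> is bounded by \<open>C\<close>, then \<open>\<psi>\<close> omits all the points where \<open>g\<close> exceeds \<open>C\<close> in modulus,
  so Montel's theorem applies to \<open>\<psi>\<close>.
\<close>
lemma normal_at_left_cancel:
  assumes g: "g holomorphic_on UNIV" "\<not> g constant_on UNIV"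
    and F: "\<And>\<psi>. \<psi> \<in> F \<Longrightarrow> \<psi> holomorphic_on UNIV"
    and N: "normal_at z ((\<lambda>\<psi>. g \<circ> \<psi>) ` F)"
  shows "normal_at z F"
proof -
  obtain r where r: "r > 0" and sub: "\<And>s :: nat \<Rightarrow> complex \<Rightarrow> complex.
      range s \<subseteq> (\<lambda>\<psi>. g \<circ> \<psi>) ` F \<Longrightarrow>
      \<exists>k :: nat \<Rightarrow> nat. strict_mono k \<and> conv_or_escape (cball z r) (s \<circ> k)"
    using N by (rule normal_atE) blast
  have g_cont: "continuous_on X g" for X
    using g(1) by (meson holomorphic_on_imp_continuous_on continuous_on_subset subset_UNIV)
  show ?thesis
  \<comment> \<open>Montel's theorem yields convergence on a strictly smaller disc, hence the half
    radius.\<close>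
  proof (rule normal_atI[of "r / 2"])
    fix s :: "nat \<Rightarrow> complex \<Rightarrow> complex" assume s: "range s \<subseteq> F"
    then have s_hol: "s n holomorphic_on X" for n X
      using F by (meson holomorphic_on_subset rangeI subsetD subset_UNIV)
    obtain k :: "nat \<Rightarrow> nat" where k: "strict_mono k"
      and ce: "conv_or_escape (cball z r) ((\<lambda>n. g \<circ> s n) \<circ> k)"
      using sub[of "\<lambda>n. g \<circ> s n"] s by blast
    from ce consider
        l where "uniform_limit (cball z r) ((\<lambda>n. g \<circ> s n) \<circ> k) l sequentially"
      | "\<And>B. \<forall>\<^sub>F n in sequentially. \<forall>w\<in>cball z r. B < norm (((\<lambda>n. g \<circ> s n) \<circ> k) n w)"
      unfolding conv_or_escape_def by blast
    then show "\<exists>k :: nat \<Rightarrow> nat. strict_mono k \<and> conv_or_escape (cball z (r / 2)) (s \<circ> k)"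
    proof cases
      case 1
      have cont: "continuous_on (cball z r) (((\<lambda>n. g \<circ> s n) \<circ> k) n)" for n
        using continuous_on_compose[OF holomorphic_on_imp_continuous_on[OF s_hol] g_cont]
        by (simp add: comp_def)
      have "continuous_on (cball z r) l"
        by (rule uniform_limit_theorem[OF _ 1]) (simp_all only: cont eventually_True trivial_limit_sequentially not_False_eq_True)
      then have "bounded (l ` cball z r)"
        by (intro compact_imp_bounded compact_continuous_image compact_cball)
      then obtain C where C: "\<And>w. w \<in> cball z r \<Longrightarrow> norm (l w) \<le> C"
        unfolding bounded_iff by blast
      have "\<forall>\<^sub>F n in sequentially. \<forall>w\<in>cball z r. dist (((\<lambda>n. g \<circ> s n) \<circ> k) n w) (l w) < 1"
        using 1 zero_less_one unfolding uniform_limit_iff by blast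
      \<comment> \<open>The distance to the limit is known to be below 1 from index \<open>M\<close>
        on, hence the shift by \<open>M\<close> below.\<close>
      then obtain M where M: "\<And>n w. n \<ge> M \<Longrightarrow> w \<in> cball z r \<Longrightarrow> dist (g (s (k n) w)) (l w) < 1"
        unfolding eventually_sequentially comp_def by blast
      have bnd: "norm (g (s (k (n + M)) w)) \<le> C + 1" if "w \<in> ball z r" for n w
      proof -
        have "w \<in> cball z r" using that by simp
        then have "dist (g (s (k (n + M)) w)) (l w) < 1" "norm (l w) \<le> C"
          using M[of "n + M" w] C by auto
        then show ?thesis
          using norm_triangle_sub[of "g (s (k (n + M)) w)" "l w"] by (simp add: dist_norm)
      qed
      \<comment> \<open>At both points \<open>g\<close> exceeds the bound \<open>C + 1\<close>, so
        they are omitted values; the larger modulus of \<open>g b\<close> makes them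
        distinct.\<close>
      obtain a where a: "C + 1 < norm (g a)" using entire_unbounded[OF g] by blast
      obtain b where b: "norm (g a) < norm (g b)" using entire_unbounded[OF g] by blast
      have "a \<noteq> b" using b by auto
      have omit: "s (k (n + M)) w \<noteq> a \<and> s (k (n + M)) w \<noteq> b" if "w \<in> ball z r" for n w
        using bnd[OF that, of n] a b by auto
      obtain k' :: "nat \<Rightarrow> nat" where k': "strict_mono k'"
        and ce': "conv_or_escape (cball z (r / 2)) ((\<lambda>n. s (k (n + M))) \<circ> k')"
        by (rule Montel_omit_two_values[OF r _ _ \<open>a \<noteq> b\<close> omit, of "r / 2"]) (use r s_hol in auto)
      have "strict_mono (\<lambda>n. k (k' n + M))"
        using k k' by (simp add: strict_mono_def)
      with ce' show ?thesis
        by (intro exI[of _ "\<lambda>n. k (k' n + M)"]) (simp add: comp_def)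
    next
      case 2
      \<comment> \<open>As \<open>g\<close> is bounded on the compact disc \<open>cball 0 B\<close>,
        large values of \<open>g \<circ> s (k n)\<close> force \<open>s (k n)\<close> out of that
        disc.\<close>
      have "\<forall>\<^sub>F n in sequentially. \<forall>w\<in>cball z r. B < norm ((s \<circ> k) n w)" for B
      proof -
        have "bounded (g ` cball 0 B)"
          using g_cont by (intro compact_imp_bounded compact_continuous_image compact_cball)
        then obtain C where "\<forall>w\<in>cball 0 B. norm (g w) \<le> C"
          unfolding bounded_iff by auto
        then have C: "norm w \<le> B \<Longrightarrow> norm (g w) \<le> C" for w by simp
        show ?thesis
        proof (rule eventually_mono[OF 2[of C]], intro ballI)
          fix n w assume "\<forall>w\<in>cball z r. C < norm (((\<lambda>n. g \<circ> s n) \<circ> k) n w)" "w \<in> cball z r"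
          then have "C < norm (g (s (k n) w))" by auto
          then show "B < norm ((s \<circ> k) n w)" using C[of "s (k n) w"] by fastforce
        qed
      qed
      then have "conv_or_escape (cball z r) (s \<circ> k)" unfolding conv_or_escape_def by blast
      then have "conv_or_escape (cball z (r / 2)) (s \<circ> k)"
        by (rule conv_or_escape_subset) (use r in auto)
      with k show ?thesis by blast
    qed
  qed (use r in simp)
qed

lemma holomorphic_on_UNIV_comp:
  "f holomorphic_on UNIV \<Longrightarrow> g holomorphic_on UNIV \<Longrightarrow> f \<circ> g holomorphic_on UNIV"
  by (meson holomorphic_on_compose holomorphic_on_subset subset_UNIV)

lemma holomorphic_on_UNIV_funpow: "h holomorphic_on UNIV \<Longrightarrow> (h ^^ n) holomorphic_on UNIV"
  by (induction n) (simp_all add: id_def holomorphic_on_UNIV_comp)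

lemma funpow_comm:
  assumes "\<And>x. f (h x) = h (f x)"
  shows "f ((h ^^ n) x) = (h ^^ n) (f x)"
  by (induction n) (simp_all add: assms)

text \<open>Stated for nonconstant entire functions so that \<open>g = id\<close> is allowed; this
  yields complete invariance of \<open>fatou_set h\<close> under \<open>h\<close> itself.\<close>

theorem fatou_set_completely_invariant:
  assumes f: "f holomorphic_on UNIV" "\<not> f constant_on UNIV"
    and g: "g holomorphic_on UNIV" "\<not> g constant_on UNIV"
    and comm: "f \<circ> g = g \<circ> f"
  shows "completely_invariant f (fatou_set (f \<circ> g))"
  unfolding completely_invariant_def
proof
  fix z
  define h where "h = f \<circ> g"
  have c: "f (g x) = g (f x)" for x using fun_cong[OF comm, of x] by simp
  let ?I = "range (\<lambda>n. h ^^ n)"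
  have h: "h holomorphic_on UNIV" unfolding h_def
    using f(1) g(1) by (rule holomorphic_on_UNIV_comp)
  have fh: "f \<circ> h ^^ n = h ^^ n \<circ> f" for n
    using funpow_comm[of f h n] by (simp add: fun_eq_iff h_def c)
  have I_hol: "\<psi> holomorphic_on UNIV" if "\<psi> \<in> ?I" for \<psi>
    using that holomorphic_on_UNIV_funpow[OF h] by auto
  \<comment> \<open>The bridge between \<open>normal_at_left_cancel\<close>, which stays at
    \<open>z\<close>, and the precomposition lemmas, which move between \<open>z\<close> and
    \<open>f z\<close>.\<close>
  have eq: "(\<lambda>\<psi>. f \<circ> \<psi>) ` ?I = (\<lambda>\<psi>. \<psi> \<circ> f) ` ?I"
    unfolding image_image fh ..
  have "z \<in> fatou_set h \<longleftrightarrow> f z \<in> fatou_set h"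
    unfolding fatou_set_iff_normal_at
  proof
    assume N: "normal_at z ?I"
    \<comment> \<open>Composing with \<open>g\<close> completes one more factor \<open>h\<close>, so
      the result is a subfamily of the iterates and inherits their normality.\<close>
    have "(\<lambda>\<psi>. g \<circ> \<psi>) ` (\<lambda>\<psi>. f \<circ> \<psi>) ` ?I \<subseteq> ?I"
    proof (clarsimp simp: image_image)
      fix n
      have "g \<circ> (f \<circ> h ^^ n) = h ^^ Suc n"
        by (simp add: fun_eq_iff h_def c)
      then show "g \<circ> (f \<circ> h ^^ n) \<in> ?I" by (metis rangeI)
    qed
    with N have 1: "normal_at z ((\<lambda>\<psi>. g \<circ> \<psi>) ` (\<lambda>\<psi>. f \<circ> \<psi>) ` ?I)"
      by (rule normal_at_mono)
    have 2: "\<phi> holomorphic_on UNIV" if \<phi>: "\<phi> \<in> (\<lambda>\<psi>. f \<circ> \<psi>) ` ?I" for \<phi>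
    proof -
      obtain n where "\<phi> = f \<circ> h ^^ n" using \<phi> by blast
      then show ?thesis
        by (simp only: holomorphic_on_UNIV_comp[OF f(1) holomorphic_on_UNIV_funpow[OF h]])
    qed
    have "normal_at z ((\<lambda>\<psi>. f \<circ> \<psi>) ` ?I)"
      using 2 1 by (rule normal_at_left_cancel[OF g])
    then show "normal_at (f z) ?I"
      unfolding eq by (rule normal_at_precompose_cancel[OF f])
  next
    assume "normal_at (f z) ?I"
    then have "normal_at z ((\<lambda>\<psi>. f \<circ> \<psi>) ` ?I)"
      unfolding eq by (rule normal_at_precompose[OF f(1)])
    with I_hol show "normal_at z ?I"
      by (rule normal_at_left_cancel[OF f])
  qed
  then show "z \<in> fatou_set (f \<circ> g) \<longleftrightarrow> f z \<in> fatou_set (f \<circ> g)"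
    unfolding h_def .
qed

section \<open>Points outside the Fatou set\<close>

lemma transcendental_entire_not_constant:
  assumes "transcendental_entire h"
  shows "\<not> h constant_on UNIV"
proof
  assume "h constant_on UNIV"
  then obtain c where "\<And>z. h z = c" unfolding constant_on_def by blast
  then have "h = poly [:c:]" by auto
  then show False using assms unfolding transcendental_entire_def by blast
qed

text \<open>Cauchy's inequality along arbitrarily large radii annihilates every Taylor coefficient
  of order at least 2.\<close>

lemma entire_linear_growth_imp_poly:
  assumes h: "h holomorphic_on UNIV"
    and growth: "\<And>R. \<exists>r\<ge>R. \<forall>w\<in>cball 0 r. norm (h w) \<le> C * r"
  shows "\<exists>p. h = poly p"
proof -
  have coeff: "(deriv ^^ n) h 0 = 0" if n: "n \<ge> 2" for n
  proof -
    define A where "A = fact n * C"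
    have bound: "\<exists>r\<ge>R. norm ((deriv ^^ n) h 0) \<le> A / r" if R: "R \<ge> 1" for R :: real
    proof -
      obtain r where r: "r \<ge> R" "\<And>w. w \<in> cball 0 r \<Longrightarrow> norm (h w) \<le> C * r"
        using growth by blast
      have C: "C \<ge> 0"
      proof -
        have "0 \<le> C * r" using r(2)[of 0] r(1) R by (smt (verit) centre_in_cball norm_ge_zero)
        then show ?thesis using r(1) R by (simp add: zero_le_mult_iff)
      qed
      have "norm ((deriv ^^ n) h 0) \<le> fact n * (C * r) / r ^ n"
      proof (rule Cauchy_inequality)
        show "h holomorphic_on ball 0 r" using h by (rule holomorphic_on_subset) simp
        show "continuous_on (cball 0 r) h"
          using h by (meson holomorphic_on_imp_continuous_on continuous_on_subset subset_UNIV)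
      qed (use r R in auto)
      also have "\<dots> = A * r / r ^ n" by (simp add: A_def)
      also have "\<dots> \<le> A * r / r ^ 2"
        using r(1) R n C by (intro divide_left_mono power_increasing mult_nonneg_nonneg) (auto simp: A_def)
      also have "\<dots> = A / r" using r(1) R by (simp add: power2_eq_square)
      finally show ?thesis using r(1) by blast
    qed
    show ?thesis
    proof (rule ccontr)
      assume "(deriv ^^ n) h 0 \<noteq> 0"
      then have d: "norm ((deriv ^^ n) h 0) > 0" (is "?d > 0") by simp
      \<comment> \<open>At such a radius \<open>?d * r\<close> exceeds \<open>\<bar>A\<bar>\<close>,
        while the Cauchy bound says \<open>?d * r \<le> A\<close>.\<close>
      obtain r where r: "r \<ge> max 1 (\<bar>A\<bar> / ?d + 1)" "?d \<le> A / r"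
        using bound[of "max 1 (\<bar>A\<bar> / ?d + 1)"] by auto
      have "r > 0" by (rule less_le_trans[OF zero_less_one]) (use r(1) in linarith)
      then have "?d * r \<le> A" using r(2) by (simp add: pos_le_divide_eq)
      moreover have "\<bar>A\<bar> < ?d * r" using r(1) d by (simp add: pos_divide_less_eq[symmetric] mult.commute)
      ultimately show False by linarith
    qed
  qed
  have "h w = poly [:h 0, deriv h 0:] w" for w
  proof -
    have "w \<in> ball 0 (norm w + 1)" by simp
    moreover have "h holomorphic_on ball 0 (norm w + 1)" using h by (rule holomorphic_on_subset) simp
    ultimately have "(\<lambda>n. (deriv ^^ n) h 0 / fact n * (w - 0) ^ n) sums h w"
      using holomorphic_power_series by blast
    moreover have "(\<lambda>n. (deriv ^^ n) h 0 / fact n * (w - 0) ^ n) sums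
        (\<Sum>n<2. (deriv ^^ n) h 0 / fact n * (w - 0) ^ n)"
      by (rule sums_finite) (auto simp: coeff)
    ultimately have "h w = (\<Sum>n<2. (deriv ^^ n) h 0 / fact n * (w - 0) ^ n)"
      by (rule sums_unique2)
    then show ?thesis by (simp add: numeral_2_eq_2 algebra_simps)
  qed
  then show ?thesis by blast
qed

text \<open>
  A weak form of Bohr's theorem: if \<open>h\<close> omitted a value of modulus \<open>2r\<close> and one of modulus \<open>4r\<close>
  on the disc of radius \<open>r\<close> for arbitrarily large \<open>r\<close>, Schottky's theorem would make \<open>h\<close> grow
  at most linearly.
\<close>
lemma transcendental_image_contains_sphere:
  assumes h: "transcendental_entire h"
  shows "\<exists>r0>0. \<forall>r\<ge>r0. \<exists>\<rho>\<ge>2 * r. sphere 0 \<rho> \<subseteq> h ` cball 0 r"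
proof (rule ccontr)
  assume no: "\<not> ?thesis"
  have hol: "h holomorphic_on UNIV" using h unfolding transcendental_entire_def by blast
  \<comment> \<open>Schottky's bound on the disc of radius 1/2 for functions of modulus at most 2 at
    the origin that omit 0 and 1 on the closed unit disc.\<close>
  define S where "S = exp (pi * exp (pi * (2 + 2 * 2 + 12 * (1 / 2) / (1 - 1 / 2))))"
  have "\<exists>r\<ge>R. \<forall>w\<in>cball 0 r. norm (h w) \<le> (12 * S + 4) * r" for R
  proof -
    \<comment> \<open>The three terms ensure \<open>r > 0\<close>, then
      \<open>norm (h 0) \<le> 2 * r\<close>, from which \<open>norm (F 0) \<le> 2\<close>, and
      finally \<open>r / 2 \<ge> R\<close>.\<close>
    define r0 where "r0 = max 1 (max (norm (h 0) / 2) (2 * R))"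
    have "r0 > 0" by (simp add: r0_def)
    then obtain r where r: "r \<ge> r0" and notin: "\<And>\<rho>. \<rho> \<ge> 2 * r \<Longrightarrow> \<not> sphere 0 \<rho> \<subseteq> h ` cball 0 r"
      using no by blast
    have rpos: "r > 0" using r \<open>r0 > 0\<close> by simp
    have omitted: "\<exists>a. norm a = \<rho> \<and> a \<notin> h ` cball 0 r" if "\<rho> \<ge> 2 * r" for \<rho>
      using notin[OF that] unfolding subset_iff mem_sphere_0 by blast
    obtain a where a: "norm a = 2 * r" "a \<notin> h ` cball 0 r"
      using omitted[of "2 * r"] by blast
    obtain b where b: "norm b = 4 * r" "b \<notin> h ` cball 0 r"
      using omitted[of "4 * r"] rpos by auto
    have ba: "norm (b - a) \<ge> 2 * r" "norm (b - a) \<le> 6 * r"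
      using a b norm_triangle_ineq2[of b a] norm_triangle_ineq4[of b a] by auto
    then have "a \<noteq> b" using rpos by auto
    \<comment> \<open>Rescales the disc of radius \<open>r\<close> to the unit disc and moves the
      omitted values to 0 and 1.\<close>
    define F where "F u = (h (of_real r * u) - a) / (b - a)" for u
    have F_bound: "norm (F u) \<le> S" if u: "norm u \<le> 1 / 2" for u
      unfolding S_def
    proof (rule Schottky[where f = F and z = u and r = 2 and t = "1 / 2"])
      have "(\<lambda>u. h (of_real r * u)) holomorphic_on cball 0 1"
        using holomorphic_on_compose[of "\<lambda>u. of_real r * u" "cball 0 1" h]
          holomorphic_on_subset[OF hol subset_UNIV]
        by (auto simp: comp_def intro!: holomorphic_intros)
      then show "F holomorphic_on cball 0 1"
        unfolding F_def using \<open>a \<noteq> b\<close> by (intro holomorphic_intros) auto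
      have "norm (h 0 - a) \<le> 2 * (2 * r)"
        using norm_triangle_ineq4[of "h 0" a] a(1) r by (auto simp: r0_def)
      also have "\<dots> \<le> 2 * norm (b - a)" using ba by simp
      finally show "norm (F 0) \<le> 2"
        using \<open>a \<noteq> b\<close> by (simp add: F_def norm_divide divide_le_eq)
      fix v :: complex assume "v \<in> cball 0 1"
      then have "of_real r * v \<in> cball 0 r" using rpos by (simp add: norm_mult)
      then have "h (of_real r * v) \<noteq> a" "h (of_real r * v) \<noteq> b" using a b by blast+
      then show "\<not> (F v = 0 \<or> F v = 1)" using \<open>a \<noteq> b\<close> by (simp add: F_def)
    qed (use u in auto)
    \<comment> \<open>Schottky's bound holds on half the radius, where
      \<open>2 * r + 6 * r * S\<close> equals \<open>(12 * S + 4) * (r / 2)\<close>.\<close>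
    have "norm (h w) \<le> (12 * S + 4) * (r / 2)" if w: "w \<in> cball 0 (r / 2)" for w
    proof -
      define u where "u = w / of_real r"
      have u: "norm u \<le> 1 / 2" using w rpos by (simp add: u_def norm_divide divide_le_eq)
      have "h w = a + (b - a) * F u"
        using \<open>a \<noteq> b\<close> rpos by (simp add: F_def u_def)
      then have "norm (h w) \<le> norm a + norm (b - a) * norm (F u)"
        by (metis norm_mult norm_triangle_ineq)
      also have "\<dots> \<le> 2 * r + 6 * r * S"
        using a(1) ba(2) F_bound[OF u] rpos by (intro add_mono mult_mono) auto
      finally show ?thesis by (simp add: algebra_simps)
    qed
    moreover have "r / 2 \<ge> R" using r by (simp add: r0_def)
    ultimately show ?thesis by blast
  qed
  then show False
    using entire_linear_growth_imp_poly[OF hol] h unfolding transcendental_entire_def by blast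
qed

text \<open>The induction peels off the first application of \<open>h\<close>: a point of the larger
  circle with a large \<open>n\<close>-th iterate has a preimage in the disc, and the maximum
  modulus principle moves the resulting bound from there to the boundary circle.\<close>

lemma sphere_iterate_growth:
  assumes h: "h holomorphic_on UNIV"
    and image: "\<And>r. r \<ge> r0 \<Longrightarrow> \<exists>\<rho>\<ge>2 * r. sphere 0 \<rho> \<subseteq> h ` cball 0 r"
    and r0: "r0 > 0"
  shows "r \<ge> r0 \<Longrightarrow> \<exists>z\<in>sphere 0 r. 2 ^ n * r \<le> norm ((h ^^ n) z)"
proof (induction n arbitrary: r)
  case 0
  show ?case by (rule bexI[of _ "of_real r"]) (use 0 r0 in auto)
next
  case (Suc n)
  obtain \<rho> where \<rho>: "\<rho> \<ge> 2 * r" "sphere 0 \<rho> \<subseteq> h ` cball 0 r"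
    using image[OF Suc.prems] by blast
  then obtain y where y: "y \<in> sphere 0 \<rho>" "2 ^ n * \<rho> \<le> norm ((h ^^ n) y)"
    using Suc.IH[of \<rho>] Suc.prems r0 by auto
  then obtain x where x: "x \<in> cball 0 r" "y = h x" using \<rho>(2) by blast
  have "2 ^ n * (2 * r) \<le> 2 ^ n * \<rho>" using \<rho>(1) by (intro mult_left_mono) auto
  moreover have "2 ^ Suc n * r = 2 ^ n * (2 * r)" by simp
  moreover have "norm ((h ^^ Suc n) x) = norm ((h ^^ n) y)" using x(2) by (simp add: funpow_swap1)
  ultimately have big: "2 ^ Suc n * r \<le> norm ((h ^^ Suc n) x)"
    using y(2) by linarith
  have iter: "(h ^^ Suc n) holomorphic_on UNIV" using h by (rule holomorphic_on_UNIV_funpow)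
  have cont: "continuous_on X (h ^^ Suc n)" for X
    using iter by (meson holomorphic_on_imp_continuous_on continuous_on_subset subset_UNIV)
  have "sphere (0 :: complex) r \<noteq> {}" using Suc.prems r0 by simp
  then obtain w where w: "w \<in> sphere 0 r"
    "\<And>v. v \<in> sphere 0 r \<Longrightarrow> norm ((h ^^ Suc n) v) \<le> norm ((h ^^ Suc n) w)"
    using continuous_attains_sup[OF compact_sphere _ continuous_on_norm[OF cont]] by metis
  have "norm ((h ^^ Suc n) x) \<le> norm ((h ^^ Suc n) w)"
  proof (rule maximum_modulus_frontier[where f = "h ^^ Suc n" and S = "cball 0 r" and \<xi> = x])
    show "h ^^ Suc n holomorphic_on interior (cball 0 r)"
      using iter by (rule holomorphic_on_subset) simp
  qed (use x w cont Suc.prems r0 in auto)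
  then show ?case using big w(1) order_trans by blast
qed

section \<open>Bounded orbits in the Fatou set\<close>

text \<open>A single bounded orbit in the disc rules out escape along any subsequence. If the
  iterates were not uniformly bounded there, indices \<open>N m\<close> and points
  \<open>x m\<close> with values above \<open>m\<close> would contradict convergence to a
  continuous, hence bounded, limit.\<close>

lemma normal_at_bounded_orbit:
  assumes h: "h holomorphic_on UNIV" and N: "normal_at z (range (\<lambda>n. h ^^ n))"
  shows "\<exists>r>0. \<forall>w\<in>cball z r. bounded (range (\<lambda>n. (h ^^ n) w)) \<longrightarrow>
      bounded (\<Union>n. (h ^^ n) ` cball z r)"
proof -
  obtain r where r: "r > 0" and sub: "\<And>s :: nat \<Rightarrow> complex \<Rightarrow> complex.
      range s \<subseteq> range (\<lambda>n. h ^^ n) \<Longrightarrow>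
      \<exists>k :: nat \<Rightarrow> nat. strict_mono k \<and> conv_or_escape (cball z r) (s \<circ> k)"
    using N by (rule normal_atE) blast
  have "bounded (\<Union>n. (h ^^ n) ` cball z r)"
    if w: "w \<in> cball z r" and bw: "bounded (range (\<lambda>n. (h ^^ n) w))" for w
  proof (rule ccontr)
    assume unb: "\<not> bounded (\<Union>n. (h ^^ n) ` cball z r)"
    have "\<exists>n x. x \<in> cball z r \<and> real m < norm ((h ^^ n) x)" for m :: nat
    proof (rule ccontr)
      assume "\<nexists>n x. x \<in> cball z r \<and> real m < norm ((h ^^ n) x)"
      then have "\<forall>y\<in>(\<Union>n. (h ^^ n) ` cball z r). norm y \<le> real m" by (force simp: not_less)
      with unb show False unfolding bounded_iff by blast
    qed
    then obtain N x where Nx: "\<And>m. x m \<in> cball z r" "\<And>m. real m < norm ((h ^^ N m) (x m))"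
      by metis
    obtain k :: "nat \<Rightarrow> nat" where k: "strict_mono k"
      and ce: "conv_or_escape (cball z r) ((\<lambda>m. h ^^ N m) \<circ> k)"
      using sub[of "\<lambda>m. h ^^ N m"] by blast
    obtain B where B: "\<And>n. norm ((h ^^ n) w) \<le> B"
      using bw unfolding bounded_iff by blast
    have "\<not> (\<forall>B. \<forall>\<^sub>F m in sequentially. \<forall>v\<in>cball z r. B < norm (((\<lambda>m. h ^^ N m) \<circ> k) m v))"
    proof
      assume "\<forall>B. \<forall>\<^sub>F m in sequentially. \<forall>v\<in>cball z r. B < norm (((\<lambda>m. h ^^ N m) \<circ> k) m v)"
      then obtain m where "B < norm (((\<lambda>m. h ^^ N m) \<circ> k) m w)"
        using w unfolding eventually_sequentially by blast
      with B show False by (simp add: not_less[symmetric])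
    qed
    with ce obtain l where l: "uniform_limit (cball z r) ((\<lambda>m. h ^^ N m) \<circ> k) l sequentially"
      unfolding conv_or_escape_def by blast
    have cont: "continuous_on (cball z r) (((\<lambda>m. h ^^ N m) \<circ> k) m)" for m
      using holomorphic_on_imp_continuous_on[OF holomorphic_on_UNIV_funpow[OF h]]
      by (auto intro: continuous_on_subset)
    have "continuous_on (cball z r) l"
      by (rule uniform_limit_theorem[OF _ l]) (simp_all only: cont eventually_True trivial_limit_sequentially not_False_eq_True)
    then have "bounded (l ` cball z r)"
      by (intro compact_imp_bounded compact_continuous_image compact_cball)
    then obtain C where C: "\<And>v. v \<in> cball z r \<Longrightarrow> norm (l v) \<le> C"
      unfolding bounded_iff by blast
    have "\<forall>\<^sub>F m in sequentially. \<forall>v\<in>cball z r. dist (((\<lambda>m. h ^^ N m) \<circ> k) m v) (l v) < 1"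
      using l zero_less_one unfolding uniform_limit_iff by blast
    then obtain M where M: "\<And>m v. m \<ge> M \<Longrightarrow> v \<in> cball z r \<Longrightarrow> dist ((h ^^ N (k m)) v) (l v) < 1"
      unfolding eventually_sequentially comp_def by blast
    \<comment> \<open>Large enough for the distance to \<open>l\<close> to be below 1 and, since
      \<open>k m \<ge> m\<close>, for the value at \<open>x (k m)\<close> to exceed
      \<open>C + 1\<close>.\<close>
    define m where "m = max M (nat \<lceil>C + 1\<rceil>)"
    have "dist ((h ^^ N (k m)) (x (k m))) (l (x (k m))) < 1" "norm (l (x (k m))) \<le> C"
      using M[of m "x (k m)"] C Nx(1) by (auto simp: m_def)
    then have "norm ((h ^^ N (k m)) (x (k m))) < C + 1"
      using norm_triangle_sub[of "(h ^^ N (k m)) (x (k m))" "l (x (k m))"] by (simp add: dist_norm)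
    moreover have "C + 1 \<le> real (k m)"
      using seq_suble[OF k, of m] by (simp add: m_def) linarith
    ultimately show False using Nx(2)[of "k m"] by linarith
  qed
  with r show ?thesis by blast
qed

lemma sphere_iterates_unbounded:
  assumes h: "transcendental_entire h"
  obtains r0 where "r0 > 0"
    "\<And>r n. r \<ge> r0 \<Longrightarrow> \<exists>z\<in>sphere 0 r. 2 ^ n * r \<le> norm ((h ^^ n) z)"
proof -
  obtain r0 where r0: "r0 > 0" "\<And>r. r \<ge> r0 \<Longrightarrow> \<exists>\<rho>\<ge>2 * r. sphere 0 \<rho> \<subseteq> h ` cball 0 r"
    using transcendental_image_contains_sphere[OF h] by blast
  have "h holomorphic_on UNIV" using h unfolding transcendental_entire_def by blast
  from sphere_iterate_growth[OF this r0(2) r0(1)] r0(1) that show ?thesis by blast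
qed

text \<open>
  The points of \<open>U\<close> with bounded orbit form a relatively open and closed subset, so one
  such point gives uniformly bounded orbits on large circles.
\<close>
lemma bounded_orbit_imp_not_subset_fatou_set:
  assumes h: "transcendental_entire h"
    and p: "p \<in> U" "bounded (range (\<lambda>n. (h ^^ n) p))"
    and U: "open U" "connected U" "bounded (- U)"
  shows "\<not> U \<subseteq> fatou_set h"
proof
  assume sub: "U \<subseteq> fatou_set h"
  have hol: "h holomorphic_on UNIV" using h unfolding transcendental_entire_def by blast
  obtain r0 where r0: "r0 > 0"
    "\<And>r n. r \<ge> r0 \<Longrightarrow> \<exists>z\<in>sphere 0 r. 2 ^ n * r \<le> norm ((h ^^ n) z)"
    by (rule sphere_iterates_unbounded[OF h]) blast
  obtain R where R: "\<forall>z\<in>- U. norm z \<le> R" using U(3) unfolding bounded_iff by blast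
  \<comment> \<open>Beyond \<open>R\<close> the circle lies in \<open>U\<close>; from
    \<open>r0\<close> on the growth estimate applies.\<close>
  define r where "r = max r0 (R + 1)"
  have r: "r > 0" using r0(1) by (simp add: r_def)
  have big: "\<exists>z\<in>sphere 0 r. 2 ^ n * r \<le> norm ((h ^^ n) z)" for n
    using r0(2) by (simp add: r_def)
  have "z \<in> U" if z: "z \<in> sphere 0 r" for z
  proof (rule ccontr)
    assume "z \<notin> U"
    then have "norm z \<le> R" using R by blast
    then show False using z by (simp add: r_def)
  qed
  then have sphere: "sphere 0 r \<subseteq> U" by blast
  define A where "A = {z. bounded (range (\<lambda>n. (h ^^ n) z))}"
  \<comment> \<open>The dichotomy makes both \<open>A\<close> and its complement open relative to
    \<open>U\<close>; the uniform bound feeds the compactness argument on the circle.\<close>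
  have loc: "\<exists>e>0. ball z e \<subseteq> A \<or> ball z e \<inter> A = {}" "z \<in> A \<Longrightarrow> \<exists>e>0. bounded (\<Union>n. (h ^^ n) ` ball z e)"
    if z: "z \<in> U" for z
  proof -
    have "normal_at z (range (\<lambda>n. h ^^ n))"
      using z sub unfolding fatou_set_iff_normal_at[symmetric] by blast
    then obtain e where e: "e > 0"
      "\<forall>w\<in>cball z e. bounded (range (\<lambda>n. (h ^^ n) w)) \<longrightarrow> bounded (\<Union>n. (h ^^ n) ` cball z e)"
      using normal_at_bounded_orbit[OF hol] by blast
    have "w \<in> A" if "v \<in> ball z e" "v \<in> A" "w \<in> ball z e" for v w
    proof -
      have "bounded (\<Union>n. (h ^^ n) ` cball z e)" using e(2) that unfolding A_def by auto
      moreover have "range (\<lambda>n. (h ^^ n) w) \<subseteq> (\<Union>n. (h ^^ n) ` cball z e)" using that(3) by auto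
      ultimately show ?thesis unfolding A_def mem_Collect_eq by (rule bounded_subset)
    qed
    then show "\<exists>e>0. ball z e \<subseteq> A \<or> ball z e \<inter> A = {}" using e(1) by blast
    assume "z \<in> A"
    then have "bounded (\<Union>n. (h ^^ n) ` cball z e)" using e unfolding A_def by auto
    then have "bounded (\<Union>n. (h ^^ n) ` ball z e)"
      by (rule bounded_subset) (use ball_subset_cball in blast)
    then show "\<exists>e>0. bounded (\<Union>n. (h ^^ n) ` ball z e)" using e(1) by blast
  qed
  have "open (U \<inter> A)" "open (U - A)"
    unfolding open_contains_ball
  proof (safe)
    fix z assume z: "z \<in> U" "z \<in> A"
    obtain d where "d > 0" "ball z d \<subseteq> U" using U(1) z(1) open_contains_ball by blast
    moreover obtain e where "e > 0" "ball z e \<subseteq> A"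
      using loc(1)[OF z(1)] z(2) by force
    ultimately show "\<exists>e>0. ball z e \<subseteq> U \<inter> A"
      by (intro exI[of _ "min d e"]) auto
  next
    fix z assume z: "z \<in> U" "z \<notin> A"
    obtain d where "d > 0" "ball z d \<subseteq> U" using U(1) z(1) open_contains_ball by blast
    moreover obtain e where "e > 0" "ball z e \<inter> A = {}"
      using loc(1)[OF z(1)] z(2) by (metis centre_in_ball subsetD)
    ultimately show "\<exists>e>0. ball z e \<subseteq> U - A"
      by (intro exI[of _ "min d e"]) auto
  qed
  then have "U - A = {}"
    using connectedD[OF U(2), of "U \<inter> A" "U - A"] p unfolding A_def by blast
  then have "sphere 0 r \<subseteq> A" using sphere by blast
  then have "\<forall>z\<in>sphere 0 r. \<exists>e>0. bounded (\<Union>n. (h ^^ n) ` ball z e)"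
    using loc(2) sphere by blast
  then obtain e where e: "\<And>z. z \<in> sphere 0 r \<Longrightarrow> e z > 0"
    "\<And>z. z \<in> sphere 0 r \<Longrightarrow> bounded (\<Union>n. (h ^^ n) ` ball z (e z))"
    by metis
  have "sphere 0 r \<subseteq> (\<Union>z\<in>sphere 0 r. ball z (e z))"
    using e(1) centre_in_ball by blast
  then obtain D where D: "D \<subseteq> sphere 0 r" "finite D" "sphere 0 r \<subseteq> (\<Union>z\<in>D. ball z (e z))"
    using compactE_image[OF compact_sphere, of "sphere 0 r" "\<lambda>z. ball z (e z)"] by blast
  \<comment> \<open>Finitely many discs give one bound for all iterates on the circle, against the
    growth \<open>2 ^ n * r\<close>.\<close>
  have "bounded (\<Union>z\<in>D. \<Union>n. (h ^^ n) ` ball z (e z))"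
    using D e(2) by (intro bounded_UN) auto
  then obtain B where B: "\<forall>y\<in>(\<Union>z\<in>D. \<Union>n. (h ^^ n) ` ball z (e z)). norm y \<le> B"
    unfolding bounded_iff by blast
  obtain n where n: "B / r < 2 ^ n" using real_arch_pow[of 2 "B / r"] by auto
  obtain z where z: "z \<in> sphere 0 r" "2 ^ n * r \<le> norm ((h ^^ n) z)" using big by blast
  have "norm ((h ^^ n) z) \<le> B" using z(1) D(3) B by blast
  with z(2) n r show False by (simp add: divide_less_eq)
qed

section \<open>Picard's theorem at infinity and transcendence of compositions\<close>

text \<open>Otherwise the great Picard theorem at 0, applied to \<open>h \<circ> inverse\<close>,
  gives \<open>h\<close> or its reciprocal a limit at infinity. In the first case \<open>h\<close>
  is constant, in the second a polynomial.\<close>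

lemma transcendental_great_Picard:
  assumes h: "transcendental_entire h" and "a \<noteq> b"
  shows "\<exists>z. R < norm z \<and> (h z = a \<or> h z = b)"
proof (rule ccontr)
  assume no: "\<nexists>z. R < norm z \<and> (h z = a \<or> h z = b)"
  have hol: "h holomorphic_on UNIV" using h unfolding transcendental_entire_def by blast
  define M where "M = ball (0 :: complex) (1 / (\<bar>R\<bar> + 1))"
  have omit: "(h \<circ> inverse) w \<noteq> a \<and> (h \<circ> inverse) w \<noteq> b" if "w \<in> M - {0}" for w
  proof -
    have "norm w < 1 / (\<bar>R\<bar> + 1)" "norm w > 0" using that by (auto simp: M_def)
    then have "inverse (1 / (\<bar>R\<bar> + 1)) < inverse (norm w)" by (intro less_imp_inverse_less)
    then have "R < norm (inverse w)" by (simp add: norm_inverse)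
    then show ?thesis using no by auto
  qed
  have hol_inv: "h \<circ> inverse holomorphic_on M - {0}"
    by (intro holomorphic_on_compose holomorphic_on_subset[OF hol subset_UNIV] holomorphic_on_inverse)
      auto
  have M: "open M" "0 \<in> M" by (auto simp: M_def)
  obtain l where
    "((h \<circ> inverse) \<longlongrightarrow> l) (at 0) \<or> ((inverse \<circ> (h \<circ> inverse)) \<longlongrightarrow> l) (at 0)"
    by (rule great_Picard[OF M \<open>a \<noteq> b\<close> hol_inv omit])
  then have "(h \<longlongrightarrow> l) at_infinity \<or> ((inverse \<circ> h) \<longlongrightarrow> l) at_infinity"
    by (simp add: lim_at_infinity_0 comp_assoc)
  then show False
  proof
    assume "(h \<longlongrightarrow> l) at_infinity"
    then have "h = poly [:l:]" using Liouville_weak[OF hol] by auto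
    then show False using h unfolding transcendental_entire_def by blast
  next
    assume "((inverse \<circ> h) \<longlongrightarrow> l) at_infinity"
    then obtain c n where "\<And>z. h z = (\<Sum>i\<le>n. c i * z ^ i)"
      using pole_at_infinity[OF hol] by metis
    then have "h = poly (\<Sum>i\<le>n. monom (c i) i)" by (auto simp: poly_sum poly_monom)
    then show False using h unfolding transcendental_entire_def by blast
  qed
qed

lemma transcendental_entire_comp:
  assumes f: "transcendental_entire f" and g: "transcendental_entire g"
  shows "transcendental_entire (f \<circ> g)"
  unfolding transcendental_entire_def
proof
  show "f \<circ> g holomorphic_on UNIV"
    using f g holomorphic_on_UNIV_comp unfolding transcendental_entire_def by blast
  show "\<nexists>p. f \<circ> g = poly p"
  proof
    assume "\<exists>p. f \<circ> g = poly p"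
    then obtain p where "f \<circ> g = poly p" by blast
    then have p: "f (g z) = poly p z" for z by (metis comp_apply)
    \<comment> \<open>Both values differ from \<open>poly p 0\<close>, so their level sets are
      finite even when \<open>p\<close> is constant.\<close>
    define a where "a = poly p 0 + 1"
    define b where "b = poly p 0 + 2"
    have "a \<noteq> b" by (simp add: a_def b_def)
    define X where "X = {w. f w = a \<or> f w = b}"
    define Z where "Z = {z. poly p z = a \<or> poly p z = b}"
    have "infinite X"
    proof
      assume "finite X"
      then obtain R where "\<forall>w\<in>X. norm w \<le> R" using finite_imp_bounded bounded_iff by metis
      then show False
        using transcendental_great_Picard[OF f \<open>a \<noteq> b\<close>, of R] by (force simp: X_def)
    qed
    have "finite {z. poly (p - [:c:]) z = 0}" if "c \<noteq> poly p 0" for c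
      using that by (intro poly_roots_finite) auto
    from this[of a] this[of b] have "finite Z"
      by (simp add: Z_def a_def b_def Collect_disj_eq)
    then have inf: "infinite (X - g ` Z)" using \<open>infinite X\<close> by simp
    then obtain u where u: "u \<in> X - g ` Z" using infinite_imp_nonempty by blast
    have "infinite (X - g ` Z - {u})" using inf by simp
    then obtain v where v: "v \<in> X - g ` Z" "u \<noteq> v" using infinite_imp_nonempty by blast
    obtain z where "g z = u \<or> g z = v" using transcendental_great_Picard[OF g v(2)] by blast
    then have gz: "g z \<in> X - g ` Z" using u v(1) by auto
    then have "z \<in> Z" unfolding X_def Z_def p[symmetric] by blast
    with gz show False by blast
  qed
qed

text \<open>The case \<open>n = 0\<close> is included, which occurs below when one factor is split
  off an iterate.\<close>

lemma transcendental_entire_funpow_comp: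
  assumes "transcendental_entire f" "transcendental_entire g"
  shows "transcendental_entire (f ^^ n \<circ> g)"
  using assms by (induction n) (simp_all add: comp_assoc transcendental_entire_comp)

lemma transcendental_entire_funpow:
  assumes "transcendental_entire f" "n > 0"
  shows "transcendental_entire (f ^^ n)"
proof -
  obtain m where "n = Suc m" using assms(2) by (cases n) auto
  then have "f ^^ n = f ^^ m \<circ> f" by (simp only: funpow_Suc_right)
  then show ?thesis using transcendental_entire_funpow_comp[OF assms(1) assms(1)] by simp
qed

text \<open>
  If the complement of the Fatou set were contained in \<open>{a}\<close>, every point with bounded orbit would
  equal \<open>a\<close>. Then \<open>a\<close> would be completely invariant, and Picard's theorem for \<open>(h z - a) / (z - a)\<close>
  gives a fixed point of \<open>h\<close> other than \<open>a\<close>.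
\<close>
theorem fatou_set_omits_two_points:
  assumes h: "transcendental_entire h"
  obtains a b where "a \<noteq> b" "a \<notin> fatou_set h" "b \<notin> fatou_set h"
proof -
  have "\<not> - {a} \<subseteq> fatou_set h" for a
  proof
    assume sub: "- {a} \<subseteq> fatou_set h"
    have hol: "h holomorphic_on UNIV" using h unfolding transcendental_entire_def by blast
    have not_poly: "h \<noteq> poly q" for q using h unfolding transcendental_entire_def by blast
    have conn: "connected (- {a})" by (rule connected_punctured_universe) simp
    \<comment> \<open>Covers fixed points as well. The bounded orbit is used twice: on the punctured
      plane it forces \<open>x = a\<close>, on the whole plane it puts \<open>a\<close> outside the
      Fatou set.\<close>
    have two_periodic_eq: "x = a \<and> x \<notin> fatou_set h" if x: "h (h x) = x" for x
    proof -
      have "(h ^^ n) x = x \<or> (h ^^ n) x = h x" for n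
        by (induction n) (use x in auto)
      then have "range (\<lambda>n. (h ^^ n) x) \<subseteq> {x, h x}" by auto
      then have bnd: "bounded (range (\<lambda>n. (h ^^ n) x))"
        by (rule bounded_subset[rotated]) simp
      have "x = a"
        using bounded_orbit_imp_not_subset_fatou_set[OF h _ bnd _ conn] sub by auto
      moreover have "\<not> UNIV \<subseteq> fatou_set h"
        using bounded_orbit_imp_not_subset_fatou_set[OF h UNIV_I bnd open_UNIV connected_UNIV] by simp
      ultimately show ?thesis using sub by auto
    qed
    \<comment> \<open>Translations are the case excluded in
      \<open>holomorphic_involution_point\<close>.\<close>
    have "h \<noteq> (\<lambda>x. c + x)" for c using not_poly[of "[:c, 1:]"] by (auto simp: fun_eq_iff)
    then obtain x where "h (h x) = x" using holomorphic_involution_point[OF hol] by blast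
    then have a: "a \<notin> fatou_set h" using two_periodic_eq by blast
    have "completely_invariant h (fatou_set (h \<circ> id))"
    proof (rule fatou_set_completely_invariant[OF hol transcendental_entire_not_constant[OF h]])
      show "\<not> id constant_on (UNIV :: complex set)"
        unfolding constant_on_def by (metis UNIV_I id_apply zero_neq_one)
      show "id holomorphic_on (UNIV :: complex set)" by (simp add: id_def)
    qed simp
    then have inv: "z \<in> fatou_set h \<longleftrightarrow> h z \<in> fatou_set h" for z
      unfolding completely_invariant_def by simp
    have ha: "h z = a \<longleftrightarrow> z = a" for z using inv[of z] a sub by (metis ComplI singletonD subsetD)
    define q where "q z = (if z = a then deriv h a else (h z - h a) / (z - a))" for z
    have "q holomorphic_on UNIV" unfolding q_def by (rule pole_lemma[OF hol]) simp
    moreover have "q \<noteq> poly p" for p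
    proof
      assume qp: "q = poly p"
      have "h z = poly ([:a:] + [:- a, 1:] * p) z" for z
      proof -
        have "h z = a + (z - a) * q z" using ha[of a] by (simp add: q_def)
        then show ?thesis by (simp add: qp algebra_simps)
      qed
      then show False using not_poly by blast
    qed
    ultimately have "transcendental_entire q" unfolding transcendental_entire_def by blast
    \<comment> \<open>The radius keeps \<open>z\<close> away from \<open>a\<close>. The value 0
      would give \<open>h z = a\<close>, so the value is 1, which means
      \<open>h z = z\<close>.\<close>
    from transcendental_great_Picard[OF this zero_neq_one, of "norm a"]
    obtain z where z: "norm a < norm z" "q z = 0 \<or> q z = 1" by blast
    then have "z \<noteq> a" by auto
    then have "h z \<noteq> a" using ha by blast
    then have "h z = z" using z(2) \<open>z \<noteq> a\<close> ha[of a] by (auto simp: q_def)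
    then show False using two_periodic_eq[of z] \<open>z \<noteq> a\<close> by simp
  qed
  then show ?thesis using that by (metis ComplD insertI1 subsetI)
qed

section \<open>Permutable functions\<close>

text \<open>The common source of all inclusions between Fatou sets: iterates of \<open>k\<close>
  keep a disc of \<open>fatou_set h\<close> inside that set, hence omit two values.\<close>

theorem forward_invariant_imp_fatou_set_subset:
  assumes h: "transcendental_entire h" and k: "k holomorphic_on UNIV"
    and inv: "\<And>z. z \<in> fatou_set h \<Longrightarrow> k z \<in> fatou_set h"
  shows "fatou_set h \<subseteq> fatou_set k"
proof
  fix z assume "z \<in> fatou_set h"
  then obtain r where r: "r > 0" "ball z r \<subseteq> fatou_set h"
    using fatou_set_open open_contains_ball by blast
  obtain a b where ab: "a \<noteq> b" "a \<notin> fatou_set h" "b \<notin> fatou_set h"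
    by (rule fatou_set_omits_two_points[OF h])
  have iter: "(k ^^ n) w \<in> fatou_set h" if "w \<in> fatou_set h" for n w
    using that by (induction n) (auto intro: inv)
  have "normal_at z (range (\<lambda>n. k ^^ n))"
  proof (rule normal_atI[of "r / 2"])
    fix s :: "nat \<Rightarrow> complex \<Rightarrow> complex" assume "range s \<subseteq> range (\<lambda>n. k ^^ n)"
    then have "\<forall>m. \<exists>n. s m = k ^^ n" by blast
    then obtain N where N: "\<And>m. s m = k ^^ N m" by metis
    have s_hol: "s n holomorphic_on ball z r" for n
      unfolding N using holomorphic_on_UNIV_funpow[OF k] by (rule holomorphic_on_subset) simp
    have omit: "s n w \<noteq> a \<and> s n w \<noteq> b" if "w \<in> ball z r" for n w
      using iter[of w "N n"] that r(2) ab(2,3) unfolding N by auto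
    have "r / 2 < r" using r(1) by simp
    from Montel_omit_two_values[where s = s, OF r(1) this s_hol ab(1) omit]
    show "\<exists>j :: nat \<Rightarrow> nat. strict_mono j \<and> conv_or_escape (cball z (r / 2)) (s \<circ> j)"
      by blast
  qed (use r in simp)
  then show "z \<in> fatou_set k" by (simp add: fatou_set_iff_normal_at)
qed

theorem theorem2p1:
  fixes f g :: "complex \<Rightarrow> complex"
  assumes "transcendental_entire f"
    and "transcendental_entire g"
    and "f \<circ> g = g \<circ> f"
  shows "(completely_invariant f (fatou_set (f \<circ> g)) \<and>
          completely_invariant g (fatou_set (f \<circ> g))) \<and>
         fatou_set (f \<circ> g) \<subseteq> fatou_set f \<inter> fatou_set g \<and>
         (\<forall>i j :: nat. 0 < i \<longrightarrow> 0 < j \<longrightarrow>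
            fatou_set ((f ^^ i) \<circ> (g ^^ j)) = fatou_set (f \<circ> g))"
proof -
  have hol: "u holomorphic_on UNIV" if "transcendental_entire u" for u
    using that unfolding transcendental_entire_def by blast
  have invariant: "completely_invariant u (fatou_set (u \<circ> v))"
    if "transcendental_entire u" "transcendental_entire v" "u \<circ> v = v \<circ> u" for u v
    using that by (intro fatou_set_completely_invariant hol transcendental_entire_not_constant)
  have inv_f: "completely_invariant f (fatou_set (f \<circ> g))"
    using invariant[OF assms] .
  have inv_g: "completely_invariant g (fatou_set (f \<circ> g))"
    using invariant[OF assms(2) assms(1) assms(3)[symmetric]] assms(3) by simp
  have trans: "transcendental_entire (f \<circ> g)"
    using assms by (intro transcendental_entire_comp)
  have subs: "fatou_set (f \<circ> g) \<subseteq> fatou_set f \<inter> fatou_set g"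
    using forward_invariant_imp_fatou_set_subset[OF trans hol[OF assms(1)]]
      forward_invariant_imp_fatou_set_subset[OF trans hol[OF assms(2)]] inv_f inv_g
    unfolding completely_invariant_def by blast
  have c: "f (g x) = g (f x)" for x using fun_cong[OF assms(3), of x] by simp
  have f_gj: "f ((g ^^ j) x) = (g ^^ j) (f x)" for j x by (rule funpow_comm) (rule c)
  have g_fi: "g ((f ^^ i) x) = (f ^^ i) (g x)" for i x by (rule funpow_comm) (rule c[symmetric])
  have "fatou_set ((f ^^ i) \<circ> (g ^^ j)) = fatou_set (f \<circ> g)" if ij: "0 < i" "0 < j" for i j
  proof -
    define k where "k = (f ^^ i) \<circ> (g ^^ j)"
    have trans_k: "transcendental_entire k"
      unfolding k_def using assms ij
      by (intro transcendental_entire_funpow_comp transcendental_entire_funpow)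
    \<comment> \<open>Splitting one factor off writes \<open>k\<close> as \<open>f\<close> or
      \<open>g\<close> composed with a function commuting with it, as \<open>invariant\<close>
      requires.\<close>
    obtain i' where i': "i = Suc i'" using ij(1) by (cases i) auto
    obtain j' where j': "j = Suc j'" using ij(2) by (cases j) auto
    have "completely_invariant f (fatou_set (f \<circ> (f ^^ i' \<circ> g ^^ j)))"
      using assms ij
      by (intro invariant transcendental_entire_funpow_comp transcendental_entire_funpow)
        (auto simp: fun_eq_iff f_gj funpow_swap1)
    moreover have "f \<circ> (f ^^ i' \<circ> g ^^ j) = k" by (simp add: k_def i' comp_assoc)
    ultimately have k_f: "completely_invariant f (fatou_set k)" by simp
    have comm_gk: "g \<circ> (g ^^ j' \<circ> f ^^ i) = (g ^^ j' \<circ> f ^^ i) \<circ> g"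
      by (auto simp: fun_eq_iff g_fi funpow_swap1)
    have "completely_invariant g (fatou_set (g \<circ> (g ^^ j' \<circ> f ^^ i)))"
      using assms ij comm_gk
      by (intro invariant transcendental_entire_funpow_comp transcendental_entire_funpow)
    moreover have "g \<circ> (g ^^ j' \<circ> f ^^ i) = k"
    proof
      fix x
      have "(g ^^ j) ((f ^^ i) x) = (f ^^ i) ((g ^^ j) x)"
        by (rule funpow_comm[symmetric]) (rule g_fi[symmetric])
      then show "(g \<circ> (g ^^ j' \<circ> f ^^ i)) x = k x" by (simp add: k_def j')
    qed
    ultimately have k_g: "completely_invariant g (fatou_set k)" by simp
    \<comment> \<open>Both \<open>f\<close> and \<open>g\<close> preserve
      \<open>fatou_set k\<close>, so \<open>f \<circ> g\<close> does; for the converse,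
      \<open>k\<close> preserves \<open>fatou_set (f \<circ> g)\<close> by iteration.\<close>
    have "fatou_set k \<subseteq> fatou_set (f \<circ> g)"
      using trans_k hol[OF trans]
      by (rule forward_invariant_imp_fatou_set_subset)
        (use k_f k_g in \<open>auto simp: completely_invariant_def\<close>)
    moreover have "fatou_set (f \<circ> g) \<subseteq> fatou_set k"
    proof (rule forward_invariant_imp_fatou_set_subset[OF trans hol[OF trans_k]])
      have iter: "(u ^^ n) z \<in> X" if "completely_invariant u X" "z \<in> X" for u n z X
        using that by (induction n) (auto simp: completely_invariant_def)
      show "k z \<in> fatou_set (f \<circ> g)" if "z \<in> fatou_set (f \<circ> g)" for z
        using iter[OF inv_f iter[OF inv_g that]] by (simp add: k_def)
    qed
    ultimately show ?thesis unfolding k_def by blast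
  qed
  with inv_f inv_g subs show ?thesis by blast
qed

end
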